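(* Let $\mathbb{K}$ be an algebraically closed field of characteristic zero. For every integer $m>1$, the $(2m+1)$-dimensional Heisenberg Lie algebra $\mathfrak{h}_m$ over $\mathbb{K}$ is non-rigid in $\mathcal{N}_{2m+1,3}$.
   Context: $\mathfrak{h}_m$ has basis $x_1,y_1,\dots,x_m,y_m,z$ with non-zero brackets of basis elements $[x_i,y_i]=z=-[y_i,x_i]$, $1\le i\le m$. For a bracket $\mu$, set $\mu^1=\mu$ and $\mu^{j}(x_1,\dots,x_{j+1})=\mu(\mu^{j-1}(x_1,\dots,x_j),x_{j+1})$. $\mathcal{N}_{n,k}$ is the affine algebraic variety (with Zariski topology) of all Lie brackets $\mu:\mathbb{K}^n\times\mathbb{K}^n\to\mathbb{K}^n$ with $\mu^k=0$, i.e. nilpotent of nilpotency index at most $k$. $\operatorname{GL}_n(\mathbb{K})$ acts by change of basis, $(g\cdot\mu)(x,y)=g\mu(g^{-1}x,g^{-1}y)$. A Lie bracket $\mu\in\mathcal{N}_{n,k}$ is rigid in $\mathcal{N}_{n,k}$ if its orbit is Zariski open in $\mathcal{N}_{n,k}$; otherwise it is non-rigid. A Lie algebra of dimension $n$ is identified with its bracket via any choice of basis. *)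

theory Defs
  imports
    "Jordan_Normal_Form.Matrix"
    "HOL-Computational_Algebra.Polynomial"
    "HOL-Analysis.Abstract_Topology"
begin

text \<open>
  Vectors of \<open>K\<^sup>n\<close> are the elements of \<open>carrier_vec n\<close>. Binary operations on \<open>K\<^sup>n\<close> are taken
  extensional (\<open>undefined\<close> outside the carrier), so that equality of operations is equality on
  \<open>K\<^sup>n\<close>.
\<close>

type_synonym 'a bracket = "'a vec \<Rightarrow> 'a vec \<Rightarrow> 'a vec"

definition bilinear_brackets :: "nat \<Rightarrow> 'a::field bracket set" where
  "bilinear_brackets n =
    {\<mu> \<in> carrier_vec n \<rightarrow>\<^sub>E (carrier_vec n \<rightarrow>\<^sub>E carrier_vec n).
      (\<forall>x \<in> carrier_vec n. \<forall>y \<in> carrier_vec n. \<forall>z \<in> carrier_vec n. \<forall>c.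
        \<mu> (x + y) z = \<mu> x z + \<mu> y z \<and> \<mu> z (x + y) = \<mu> z x + \<mu> z y \<and>
        \<mu> (c \<cdot>\<^sub>v x) z = c \<cdot>\<^sub>v \<mu> x z \<and> \<mu> z (c \<cdot>\<^sub>v x) = c \<cdot>\<^sub>v \<mu> z x)}"

definition lie_brackets :: "nat \<Rightarrow> 'a::field bracket set" where
  "lie_brackets n =
    {\<mu> \<in> bilinear_brackets n.
      (\<forall>x \<in> carrier_vec n. \<mu> x x = 0\<^sub>v n) \<and>
      (\<forall>x \<in> carrier_vec n. \<forall>y \<in> carrier_vec n. \<forall>z \<in> carrier_vec n.
        \<mu> (\<mu> x y) z + \<mu> (\<mu> y z) x + \<mu> (\<mu> z x) y = 0\<^sub>v n)}"

text \<open>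
  With arguments indexed from 0, \<open>iter_bracket \<mu> x j\<close> is the left-normed product
  \<open>\<mu>\<^sup>j(x 0, \<dots>, x j)\<close>; in particular \<open>iter_bracket \<mu> x 1 = \<mu> (x 0) (x 1)\<close>.
\<close>

primrec iter_bracket :: "'a bracket \<Rightarrow> (nat \<Rightarrow> 'a vec) \<Rightarrow> nat \<Rightarrow> 'a vec" where
  "iter_bracket \<mu> x 0 = x 0"
| "iter_bracket \<mu> x (Suc j) = \<mu> (iter_bracket \<mu> x j) (x (Suc j))"

definition nilpotent_brackets :: "nat \<Rightarrow> nat \<Rightarrow> 'a::field bracket set" where
  "nilpotent_brackets n k =
    {\<mu> \<in> lie_brackets n.
      \<forall>x. (\<forall>i \<le> k. x i \<in> carrier_vec n) \<longrightarrow> iter_bracket \<mu> x k = 0\<^sub>v n}"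

text \<open>
  Polynomial functions in a given family \<open>C\<close> of coordinate functions, and the Zariski topology
  on \<open>X\<close> whose closed sets are the common zero loci in \<open>X\<close> of sets of such polynomial functions.
\<close>

inductive_set polynomial_functions :: "('b \<Rightarrow> 'a::comm_ring_1) set \<Rightarrow> ('b \<Rightarrow> 'a) set"
  for C :: "('b \<Rightarrow> 'a) set" where
  coord: "f \<in> C \<Longrightarrow> f \<in> polynomial_functions C"
| const: "(\<lambda>_. c) \<in> polynomial_functions C"
| add: "\<lbrakk>p \<in> polynomial_functions C; q \<in> polynomial_functions C\<rbrakk>
    \<Longrightarrow> (\<lambda>v. p v + q v) \<in> polynomial_functions C"
| mult: "\<lbrakk>p \<in> polynomial_functions C; q \<in> polynomial_functions C\<rbrakk>
    \<Longrightarrow> (\<lambda>v. p v * q v) \<in> polynomial_functions C"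

definition zero_locus :: "'b set \<Rightarrow> ('b \<Rightarrow> 'a::zero) set \<Rightarrow> 'b set" where
  "zero_locus X S = {v \<in> X. \<forall>p \<in> S. p v = 0}"

definition zariski_topology :: "'b set \<Rightarrow> ('b \<Rightarrow> 'a::idom) set \<Rightarrow> 'b topology" where
  "zariski_topology X C =
    topology (\<lambda>U. \<exists>S \<subseteq> polynomial_functions C. U = X - zero_locus X S)"

lemma istopology_zariski:
  fixes C :: "('b \<Rightarrow> 'a::idom) set"
  shows "istopology (\<lambda>U. \<exists>S \<subseteq> polynomial_functions C. U = X - zero_locus X S)"
    (is "istopology ?open")
  unfolding istopology_def
proof (intro conjI allI impI)
  fix U V assume "?open U" "?open V"
  then obtain S T where S: "S \<subseteq> polynomial_functions C" "U = X - zero_locus X S"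
    and T: "T \<subseteq> polynomial_functions C" "V = X - zero_locus X T" by blast
  define R where "R = {(\<lambda>v. p v * q v) | p q. p \<in> S \<and> q \<in> T}"
  have "R \<subseteq> polynomial_functions C"
    using S(1) T(1) by (auto simp: R_def intro!: polynomial_functions.mult)
  moreover have "U \<inter> V = X - zero_locus X R"
  proof (intro equalityI subsetI)
    fix v assume "v \<in> U \<inter> V"
    then obtain p q where v: "v \<in> X" "p \<in> S" "p v \<noteq> 0" "q \<in> T" "q v \<noteq> 0"
      by (auto simp: S T zero_locus_def)
    then have "(\<lambda>v. p v * q v) \<in> R" "p v * q v \<noteq> 0"
      by (auto simp: R_def)
    then show "v \<in> X - zero_locus X R"
      using v(1) by (force simp: zero_locus_def)
  next
    fix v assume "v \<in> X - zero_locus X R"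
    then show "v \<in> U \<inter> V"
      by (auto simp: S T R_def zero_locus_def)
  qed
  ultimately show "?open (U \<inter> V)" by blast
next
  fix \<K> assume "\<forall>U \<in> \<K>. ?open U"
  then obtain S where S: "\<And>U. U \<in> \<K> \<Longrightarrow> S U \<subseteq> polynomial_functions C"
      "\<And>U. U \<in> \<K> \<Longrightarrow> U = X - zero_locus X (S U)"
    by metis
  have "(\<Union>U \<in> \<K>. S U) \<subseteq> polynomial_functions C"
    using S(1) by blast
  moreover have "\<Union>\<K> = (\<Union>U \<in> \<K>. X - zero_locus X (S U))"
    using S(2) by auto
  then have "\<Union>\<K> = X - zero_locus X (\<Union>U \<in> \<K>. S U)"
    by (auto simp: zero_locus_def)
  ultimately show "?open (\<Union>\<K>)" by blast
qed

lemma openin_zariski_topology: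
  "openin (zariski_topology X C) U \<longleftrightarrow>
    (\<exists>S \<subseteq> polynomial_functions C. U = X - zero_locus X S)"
  unfolding zariski_topology_def by (simp add: istopology_zariski)

text \<open>
  The coordinates of a bilinear operation are its structure constants; they identify
  \<open>bilinear_brackets n\<close> with affine space of dimension \<open>n\<^sup>3\<close>.
\<close>

definition structure_coords :: "nat \<Rightarrow> ('a::field bracket \<Rightarrow> 'a) set" where
  "structure_coords n =
    {(\<lambda>\<mu>. \<mu> (unit_vec n i) (unit_vec n j) $ l) | i j l. i < n \<and> j < n \<and> l < n}"

definition nilpotent_variety :: "nat \<Rightarrow> nat \<Rightarrow> 'a::field bracket topology" where
  "nilpotent_variety n k =
    subtopology (zariski_topology (bilinear_brackets n) (structure_coords n))
      (nilpotent_brackets n k)"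

text \<open>The change of basis \<open>g \<cdot> \<mu>\<close>, where \<open>h\<close> stands for the inverse of \<open>g\<close>.\<close>

definition change_basis :: "nat \<Rightarrow> 'a::field mat \<Rightarrow> 'a mat \<Rightarrow> 'a bracket \<Rightarrow> 'a bracket" where
  "change_basis n g h \<mu> =
    (\<lambda>x \<in> carrier_vec n. \<lambda>y \<in> carrier_vec n. g *\<^sub>v \<mu> (h *\<^sub>v x) (h *\<^sub>v y))"

definition GL_orbit :: "nat \<Rightarrow> 'a::field bracket \<Rightarrow> 'a bracket set" where
  "GL_orbit n \<mu> =
    {change_basis n g h \<mu> | g h.
      g \<in> carrier_mat n n \<and> h \<in> carrier_mat n n \<and> inverts_mat g h \<and> inverts_mat h g}"

definition rigid :: "nat \<Rightarrow> nat \<Rightarrow> 'a::field bracket \<Rightarrow> bool" where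
  "rigid n k \<mu> \<longleftrightarrow>
    \<mu> \<in> nilpotent_brackets n k \<and> openin (nilpotent_variety n k) (GL_orbit n \<mu>)"

definition non_rigid :: "nat \<Rightarrow> nat \<Rightarrow> 'a::field bracket \<Rightarrow> bool" where
  "non_rigid n k \<mu> \<longleftrightarrow> \<mu> \<in> nilpotent_brackets n k \<and> \<not> rigid n k \<mu>"

definition bilinear_extension :: "nat \<Rightarrow> (nat \<Rightarrow> nat \<Rightarrow> 'a::field vec) \<Rightarrow> 'a bracket" where
  "bilinear_extension n B =
    (\<lambda>x \<in> carrier_vec n. \<lambda>y \<in> carrier_vec n.
      vec n (\<lambda>l. \<Sum>p<n. \<Sum>q<n. x $ p * y $ q * B p q $ l))"

text \<open>
  The ordered basis \<open>x\<^sub>1, y\<^sub>1, \<dots>, x\<^sub>m, y\<^sub>m, z\<close> of the Heisenberg algebra is identified with the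
  standard basis of \<open>K\<^sup>2\<^sup>m\<^sup>+\<^sup>1\<close>: with \<open>i\<close> running from 0, \<open>x\<^bsub>i+1\<^esub>\<close> has index \<open>2 * i\<close>, \<open>y\<^bsub>i+1\<^esub>\<close>
  has index \<open>2 * i + 1\<close>, and \<open>z\<close> has index \<open>2 * m\<close>.
\<close>

definition heisenberg :: "nat \<Rightarrow> 'a::field bracket" where
  "heisenberg m =
    bilinear_extension (2 * m + 1)
      (\<lambda>p q. if \<exists>i<m. p = 2 * i \<and> q = 2 * i + 1 then unit_vec (2 * m + 1) (2 * m)
             else if \<exists>i<m. p = 2 * i + 1 \<and> q = 2 * i then - unit_vec (2 * m + 1) (2 * m)
             else 0\<^sub>v (2 * m + 1))"

lemma bilinear_extension_unit_vec:
  assumes "p < n" "q < n" "B p q \<in> carrier_vec n"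
  shows "bilinear_extension n B (unit_vec n p) (unit_vec n q) = B p q"
proof -
  have "(\<Sum>a<n. \<Sum>b<n. unit_vec n p $ a * unit_vec n q $ b * B a b $ l) = B p q $ l" for l
  proof -
    have "(\<Sum>a<n. \<Sum>b<n. unit_vec n p $ a * unit_vec n q $ b * B a b $ l)
        = (\<Sum>a<n. if a = p then (\<Sum>b<n. if b = q then B a b $ l else 0) else 0)"
      using assms(1,2) by (intro sum.cong refl) (auto simp: if_distrib[of "\<lambda>c. c * _"] cong: if_cong)
    also have "\<dots> = B p q $ l"
      using assms(1,2) by (simp add: sum.delta)
    finally show ?thesis .
  qed
  then show ?thesis
    using assms(3) by (auto simp: bilinear_extension_def intro!: eq_vecI)
qed

lemma heisenberg_xy:
  assumes "i < m"
  shows "heisenberg m (unit_vec (2 * m + 1) (2 * i)) (unit_vec (2 * m + 1) (2 * i + 1))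
    = (unit_vec (2 * m + 1) (2 * m) :: 'a::field vec)"
  using assms unfolding heisenberg_def by (subst bilinear_extension_unit_vec) auto

end

theory Submission
  imports Defs
begin

text \<open>
  Perturb the Heisenberg bracket by \<open>[x\<^sub>1, x\<^sub>2] = t y\<^sub>1\<close>. For every \<open>t\<close> this is a Lie bracket with
  \<open>\<mu>\<^sup>3 = 0\<close>: double products are multiples of \<open>z\<close>, and the only nonzero ones on basis vectors
  come from \<open>[[x\<^sub>1, x\<^sub>2], x\<^sub>1] = - t z\<close>. For \<open>t \<noteq> 0\<close> it is not two-step nilpotent, hence lies outside
  the orbit of the Heisenberg bracket. A polynomial function not vanishing at \<open>t = 0\<close> vanishes
  for only finitely many \<open>t\<close>, so every Zariski neighbourhood of the Heisenberg bracket contains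
  some perturbation with \<open>t \<noteq> 0\<close>.
\<close>

definition symplectic_form :: "nat \<Rightarrow> 'a::field vec \<Rightarrow> 'a vec \<Rightarrow> 'a" where
  "symplectic_form m x y = (\<Sum>i<m. x $ (2 * i) * y $ (2 * i + 1) - x $ (2 * i + 1) * y $ (2 * i))"

text \<open>Indices 0, 1 and 2 stand for \<open>x\<^sub>1\<close>, \<open>y\<^sub>1\<close> and
  \<open>x\<^sub>2\<close>. The closed formula makes bilinearity and affine dependence on
  \<open>t\<close> visible, and the restrictions to the carrier keep the operation
  extensional.\<close>

definition heisenberg_deformation :: "nat \<Rightarrow> 'a::field \<Rightarrow> 'a bracket" where
  "heisenberg_deformation m t =
    (\<lambda>x \<in> carrier_vec (2 * m + 1). \<lambda>y \<in> carrier_vec (2 * m + 1).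
      symplectic_form m x y \<cdot>\<^sub>v unit_vec (2 * m + 1) (2 * m)
      + (t * (x $ 0 * y $ 2 - x $ 2 * y $ 0)) \<cdot>\<^sub>v unit_vec (2 * m + 1) 1)"

lemma sum_lessThan_double:
  fixes f :: "nat \<Rightarrow> 'a::comm_monoid_add"
  shows "(\<Sum>p<2 * m. f p) = (\<Sum>i<m. f (2 * i) + f (2 * i + 1))"
  by (induction m) (simp_all add: add.assoc)

text \<open>Each row of the table of structure constants has at most one nonzero entry, so the
  double sum collapses to one term per basis vector, and these are grouped into the pairs
  \<open>x\<^sub>i\<close>, \<open>y\<^sub>i\<close>.\<close>

lemma heisenberg_eq_symplectic_form:
  fixes x y :: "'a::field vec"
  assumes "x \<in> carrier_vec (2 * m + 1)" "y \<in> carrier_vec (2 * m + 1)"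
  shows "heisenberg m x y = symplectic_form m x y \<cdot>\<^sub>v unit_vec (2 * m + 1) (2 * m)"
proof (rule eq_vecI)
  fix l assume "l < dim_vec (symplectic_form m x y \<cdot>\<^sub>v unit_vec (2 * m + 1) (2 * m))"
  then have l: "l < 2 * m + 1" by simp
  define B :: "nat \<Rightarrow> nat \<Rightarrow> 'a vec" where
    "B = (\<lambda>p q. if \<exists>i<m. p = 2 * i \<and> q = 2 * i + 1 then unit_vec (2 * m + 1) (2 * m)
             else if \<exists>i<m. p = 2 * i + 1 \<and> q = 2 * i then - unit_vec (2 * m + 1) (2 * m)
             else 0\<^sub>v (2 * m + 1))"
  let ?u = "unit_vec (2 * m + 1) (2 * m) $ l :: 'a"
  let ?f = "\<lambda>p. \<Sum>q<2 * m + 1. x $ p * y $ q * B p q $ l"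
  have even_row: "?f (2 * i) = x $ (2 * i) * y $ (2 * i + 1) * ?u" if "i < m" for i
  proof -
    have "B (2 * i) q $ l = (if q = 2 * i + 1 then ?u else 0)" for q
      using that l by (auto simp: B_def) presburger+
    then have "?f (2 * i)
        = (\<Sum>q<2 * m + 1. if q = 2 * i + 1 then x $ (2 * i) * y $ q * ?u else 0)"
      by (intro sum.cong) auto
    then show ?thesis using that by simp
  qed
  have odd_row: "?f (2 * i + 1) = - (x $ (2 * i + 1) * y $ (2 * i) * ?u)" if "i < m" for i
  proof -
    have "B (2 * i + 1) q $ l = (if q = 2 * i then - ?u else 0)" for q
      using that l by (auto simp: B_def) presburger+
    then have "?f (2 * i + 1)
        = (\<Sum>q<2 * m + 1. if q = 2 * i then - (x $ (2 * i + 1) * y $ q * ?u) else 0)"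
      by (intro sum.cong) auto
    then show ?thesis using that by simp
  qed
  have last_row: "?f (2 * m) = 0"
  proof -
    have "B (2 * m) q $ l = 0" for q
      using l by (auto simp: B_def) presburger+
    then show ?thesis by simp
  qed
  have "heisenberg m x y $ l = (\<Sum>p<2 * m + 1. ?f p)"
    using assms l by (simp add: heisenberg_def bilinear_extension_def B_def)
  also have "\<dots> = (\<Sum>p<2 * m. ?f p)"
    using last_row by simp
  also have "\<dots> = (\<Sum>i<m. ?f (2 * i) + ?f (2 * i + 1))"
    by (rule sum_lessThan_double)
  also have "\<dots> = symplectic_form m x y * ?u"
    unfolding symplectic_form_def sum_distrib_right
    by (intro sum.cong) (simp_all only: even_row odd_row lessThan_iff, simp add: algebra_simps)
  finally show "heisenberg m x y $ l
      = (symplectic_form m x y \<cdot>\<^sub>v unit_vec (2 * m + 1) (2 * m)) $ l"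
    using l by simp
qed (use assms in \<open>simp add: heisenberg_def bilinear_extension_def\<close>)

lemma heisenberg_deformation_0: "heisenberg_deformation m 0 = (heisenberg m :: 'a::field bracket)"
proof (intro ext)
  fix x y :: "'a vec"
  show "heisenberg_deformation m 0 x y = heisenberg m x y"
  proof (cases "x \<in> carrier_vec (2 * m + 1) \<and> y \<in> carrier_vec (2 * m + 1)")
    case True
    then show ?thesis
      by (subst heisenberg_eq_symplectic_form) (auto simp: heisenberg_deformation_def)
  next
    \<comment> \<open>Outside the carrier both sides are the same default value of
      \<open>restrict\<close>.\<close>
    case False
    then show ?thesis
      by (auto simp: heisenberg_deformation_def heisenberg_def bilinear_extension_def)
  qed
qed

lemma symplectic_form_linear:
  fixes x y w :: "'a::field vec"
  assumes "x \<in> carrier_vec (2 * m + 1)" "y \<in> carrier_vec (2 * m + 1)" "w \<in> carrier_vec (2 * m + 1)"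
  shows "symplectic_form m (x + y) w = symplectic_form m x w + symplectic_form m y w"
    and "symplectic_form m w (x + y) = symplectic_form m w x + symplectic_form m w y"
    and "symplectic_form m (c \<cdot>\<^sub>v x) w = c * symplectic_form m x w"
    and "symplectic_form m w (c \<cdot>\<^sub>v x) = c * symplectic_form m w x"
  using assms unfolding symplectic_form_def
  by (auto simp: sum_distrib_left sum.distrib[symmetric] algebra_simps intro!: sum.cong)

lemma heisenberg_deformation_closed:
  fixes x y :: "'a::field vec"
  assumes "x \<in> carrier_vec (2 * m + 1)" "y \<in> carrier_vec (2 * m + 1)"
  shows "heisenberg_deformation m t x y \<in> carrier_vec (2 * m + 1)"
  using assms by (simp add: heisenberg_deformation_def)

context
  fixes m :: nat
  assumes m: "m > 1"
begin

text \<open>All products of the deformed bracket lie in the span of \<open>z\<close> and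
  \<open>y\<^sub>1\<close>. The form has \<open>z\<close> in its radical, and it pairs
  \<open>y\<^sub>1\<close> with \<open>x\<^sub>1\<close> only.\<close>

lemma symplectic_form_unit_vec:
  fixes w :: "'a::field vec"
  shows "symplectic_form m (unit_vec (2 * m + 1) (2 * m)) w = 0"
    and "symplectic_form m (unit_vec (2 * m + 1) 1) w = - w $ 0"
proof -
  show "symplectic_form m (unit_vec (2 * m + 1) (2 * m)) w = 0"
    unfolding symplectic_form_def by (rule sum.neutral) auto
  have "symplectic_form m (unit_vec (2 * m + 1) 1) w = (\<Sum>i<m. if i = 0 then - w $ 0 else 0)"
    unfolding symplectic_form_def by (rule sum.cong) auto
  then show "symplectic_form m (unit_vec (2 * m + 1) 1) w = - w $ 0"
    using m by simp
qed

text \<open>Only the \<open>y\<^sub>1\<close> component of the inner product survives, through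
  \<open>[y\<^sub>1, x\<^sub>1] = - z\<close>. This formula yields the Jacobi identity, nilpotency
  and the separation from the orbit.\<close>

lemma heisenberg_deformation_double:
  fixes x y w :: "'a::field vec"
  assumes "x \<in> carrier_vec (2 * m + 1)" "y \<in> carrier_vec (2 * m + 1)" "w \<in> carrier_vec (2 * m + 1)"
  shows "heisenberg_deformation m t (heisenberg_deformation m t x y) w
    = - (t * (x $ 0 * y $ 2 - x $ 2 * y $ 0) * w $ 0) \<cdot>\<^sub>v unit_vec (2 * m + 1) (2 * m)"
proof -
  let ?v = "heisenberg_deformation m t x y"
  have v: "?v = symplectic_form m x y \<cdot>\<^sub>v unit_vec (2 * m + 1) (2 * m)
      + (t * (x $ 0 * y $ 2 - x $ 2 * y $ 0)) \<cdot>\<^sub>v unit_vec (2 * m + 1) 1"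
    using assms by (simp add: heisenberg_deformation_def)
  have "symplectic_form m ?v w = - (t * (x $ 0 * y $ 2 - x $ 2 * y $ 0) * w $ 0)"
    using assms unfolding v by (simp add: symplectic_form_linear symplectic_form_unit_vec[simplified])
  \<comment> \<open>Here \<open>m > 1\<close> is essential: for \<open>m = 1\<close>, index 2 would
    be that of \<open>z\<close>.\<close>
  moreover have "?v $ 0 = 0" "?v $ 2 = 0"
    using m unfolding v by auto
  ultimately show ?thesis
    using assms heisenberg_deformation_closed[OF assms(1,2), of t]
    by (subst heisenberg_deformation_def) (auto intro!: eq_vecI)
qed

lemma heisenberg_deformation_lie: "heisenberg_deformation m t \<in> lie_brackets (2 * m + 1)"
proof -
  have "heisenberg_deformation m t \<in> bilinear_brackets (2 * m + 1)"
    using m unfolding bilinear_brackets_def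
    by (auto simp: heisenberg_deformation_def symplectic_form_linear algebra_simps intro!: eq_vecI)
  moreover have "heisenberg_deformation m t x x = 0\<^sub>v (2 * m + 1)"
    if "x \<in> carrier_vec (2 * m + 1)" for x
    using that
    by (auto simp: heisenberg_deformation_def symplectic_form_def mult.commute intro!: eq_vecI)
  \<comment> \<open>The Jacobi sum is, up to the factor \<open>- t\<close>, a 3 by 3 determinant
    with rows the coordinates 0, 2 and again 0 of the three vectors, hence zero.\<close>
  ultimately show ?thesis
    unfolding lie_brackets_def
    by (auto simp: heisenberg_deformation_double[simplified] algebra_simps intro!: eq_vecI)
qed

lemma heisenberg_deformation_nilpotent:
  "heisenberg_deformation m t \<in> nilpotent_brackets (2 * m + 1) 3"
proof -
  let ?\<mu> = "heisenberg_deformation m t"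
  have "iter_bracket ?\<mu> x 3 = 0\<^sub>v (2 * m + 1)"
    if x: "\<forall>i \<le> 3. x i \<in> carrier_vec (2 * m + 1)" for x
  proof -
    have "?\<mu> (x 0) (x 1) $ 0 = 0" "?\<mu> (x 0) (x 1) $ 2 = 0"
      using m x by (auto simp: heisenberg_deformation_def)
    \<comment> \<open>The double product formula is applied with \<open>?\<mu> (x 0) (x 1)\<close>
      as first argument; its coordinates 0 and 2 vanish, and so does the coefficient.\<close>
    then have "?\<mu> (?\<mu> (?\<mu> (x 0) (x 1)) (x 2)) (x 3) = 0\<^sub>v (2 * m + 1)"
      using x by (subst heisenberg_deformation_double) (auto simp: heisenberg_deformation_closed[simplified])
    then show ?thesis by (simp add: numeral_eq_Suc)
  qed
  then show ?thesis
    by (simp add: nilpotent_brackets_def heisenberg_deformation_lie[simplified])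
qed

text \<open>Vanishing of all double products is invariant under change of basis. It holds for the
  Heisenberg bracket but fails here, since
  \<open>[[x\<^sub>1, x\<^sub>2], x\<^sub>1] = - t z\<close>.\<close>

lemma heisenberg_deformation_notin_orbit:
  fixes t :: "'a::field"
  assumes "t \<noteq> 0"
  shows "heisenberg_deformation m t \<notin> GL_orbit (2 * m + 1) (heisenberg m)"
proof
  let ?n = "2 * m + 1"
  \<comment> \<open>Writing the Heisenberg bracket as the member \<open>t = 0\<close> makes the
    double product formula available for it too.\<close>
  let ?\<mu> = "heisenberg_deformation m t" and ?\<nu> = "heisenberg_deformation m (0 :: 'a)"
  let ?e = "unit_vec ?n :: nat \<Rightarrow> 'a vec"
  assume "?\<mu> \<in> GL_orbit ?n (heisenberg m)"
  then obtain g h where g: "g \<in> carrier_mat ?n ?n" and h: "h \<in> carrier_mat ?n ?n"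
    and hg: "inverts_mat h g" and \<mu>: "?\<mu> = change_basis ?n g h ?\<nu>"
    unfolding GL_orbit_def heisenberg_deformation_0 by blast
  have cancel: "h *\<^sub>v (g *\<^sub>v v) = v" if "v \<in> carrier_vec ?n" for v
    using that g h hg by (simp add: inverts_mat_def assoc_mult_mat_vec[symmetric])
  have "?\<mu> (?\<mu> (?e 0) (?e 2)) (?e 0)
      = g *\<^sub>v ?\<nu> (?\<nu> (h *\<^sub>v ?e 0) (h *\<^sub>v ?e 2)) (h *\<^sub>v ?e 0)"
    using g h heisenberg_deformation_closed[of "h *\<^sub>v ?e 0" m "h *\<^sub>v ?e 2" 0]
    unfolding \<mu> by (simp add: change_basis_def cancel[simplified])
  also have "\<dots> = 0\<^sub>v ?n"
    using g h by (subst heisenberg_deformation_double) auto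
  finally have "?\<mu> (?\<mu> (?e 0) (?e 2)) (?e 0) $ (2 * m) = 0"
    by simp
  then show False
    using assms m by (subst (asm) heisenberg_deformation_double) auto
qed

end

text \<open>Restriction to a line turns a polynomial function into a polynomial in one variable,
  whose roots can be counted.\<close>

lemma polynomial_function_along_affine_line:
  fixes \<gamma> :: "'a::comm_ring_1 \<Rightarrow> 'b"
  assumes "p \<in> polynomial_functions C"
    and "\<And>f. f \<in> C \<Longrightarrow> \<exists>a b. \<forall>t. f (\<gamma> t) = a + t * b"
  shows "\<exists>q. \<forall>t. p (\<gamma> t) = poly q t"
  using assms(1)
proof (induction rule: polynomial_functions.induct)
  case (coord f)
  then obtain a b where "\<forall>t. f (\<gamma> t) = a + t * b" using assms(2) by blast
  then have "\<forall>t. f (\<gamma> t) = poly [:a, b:] t" by simp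
  then show ?case by blast
next
  case (const c)
  have "\<forall>t. c = poly [:c:] t" by simp
  then show ?case by blast
next
  case (add p q)
  then show ?case by (metis poly_add)
next
  case (mult p q)
  then show ?case by (metis poly_mult)
qed

lemma exists_nonzero_nonroot:
  fixes q :: "'a::{idom, ring_char_0} poly"
  assumes "q \<noteq> 0"
  shows "\<exists>t. t \<noteq> 0 \<and> poly q t \<noteq> 0"
proof -
  have "finite (insert 0 {t. poly q t = 0})"
    using assms by (simp add: poly_roots_finite)
  then show ?thesis
    using ex_new_if_finite[OF infinite_UNIV_char_0] by blast
qed

theorem theorem5p2:
  fixes m :: nat
  assumes "m > 1"
  shows "non_rigid (2 * m + 1) 3
    (heisenberg m :: 'a::{alg_closed_field, field_char_0} bracket)"
proof -
  let ?n = "2 * m + 1" and ?h = "heisenberg m :: 'a bracket"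
  let ?\<mu> = "heisenberg_deformation m :: 'a \<Rightarrow> 'a bracket"
  have nilp: "?\<mu> t \<in> nilpotent_brackets ?n 3" for t
    using assms by (rule heisenberg_deformation_nilpotent)
  have bil: "?\<mu> t \<in> bilinear_brackets ?n" for t
    using nilp[of t] by (simp add: nilpotent_brackets_def lie_brackets_def)
  have "\<not> openin (nilpotent_variety ?n 3) (GL_orbit ?n ?h)"
  proof
    assume "openin (nilpotent_variety ?n 3) (GL_orbit ?n ?h)"
    then obtain S where S: "S \<subseteq> polynomial_functions (structure_coords ?n)"
      and orbit: "GL_orbit ?n ?h
        = (bilinear_brackets ?n - zero_locus (bilinear_brackets ?n) S) \<inter> nilpotent_brackets ?n 3"
      unfolding nilpotent_variety_def openin_subtopology openin_zariski_topology by blast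
    have "change_basis ?n (1\<^sub>m ?n) (1\<^sub>m ?n) (?\<mu> 0) = ?\<mu> 0"
      by (intro ext) (auto simp: change_basis_def heisenberg_deformation_def restrict_def)
    then have "?\<mu> 0 \<in> GL_orbit ?n ?h"
      unfolding GL_orbit_def heisenberg_deformation_0
      by (auto simp: inverts_mat_def intro!: exI[of _ "1\<^sub>m ?n"])
    \<comment> \<open>This \<open>p\<close> cuts out a basic open neighbourhood of the Heisenberg
      bracket; inside the variety that neighbourhood is contained in the orbit.\<close>
    then obtain p where p: "p \<in> S" "p (?\<mu> 0) \<noteq> 0"
      unfolding orbit zero_locus_def by blast
    \<comment> \<open>The family is a line in the affine space of structure constants.\<close>
    have "\<exists>a b. \<forall>t. f (?\<mu> t) = a + t * b" if f_coord: "f \<in> structure_coords ?n" for f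
    proof -
      obtain i j l where "l < ?n"
        and f: "f = (\<lambda>\<mu>. \<mu> (unit_vec ?n i) (unit_vec ?n j) $ l)"
        using f_coord unfolding structure_coords_def by blast
      let ?x = "unit_vec ?n i :: 'a vec" and ?y = "unit_vec ?n j :: 'a vec"
      have "\<forall>t. f (?\<mu> t) = symplectic_form m ?x ?y * unit_vec ?n (2 * m) $ l
          + t * ((?x $ 0 * ?y $ 2 - ?x $ 2 * ?y $ 0) * unit_vec ?n 1 $ l)"
        using \<open>l < ?n\<close> by (simp add: f heisenberg_deformation_def)
      then show ?thesis by blast
    qed
    then obtain q where q: "\<And>t. p (?\<mu> t) = poly q t"
      using polynomial_function_along_affine_line[of p "structure_coords ?n" ?\<mu>] p(1) S by blast
    then have "q \<noteq> 0" using p(2) by auto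
    then obtain t where "t \<noteq> 0" "p (?\<mu> t) \<noteq> 0"
      using exists_nonzero_nonroot q by metis
    then have "?\<mu> t \<in> GL_orbit ?n ?h"
      unfolding orbit zero_locus_def using bil[of t] nilp[of t] p(1) by blast
    then show False
      using heisenberg_deformation_notin_orbit[OF assms \<open>t \<noteq> 0\<close>] by blast
  qed
  then show ?thesis
    using nilp[of 0] by (simp add: non_rigid_def rigid_def heisenberg_deformation_0)
qed

end
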